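(* Let $(p_{mn} \colon X_n \to X_m)_{m \leq n \in \mathbb N}$ be a projective system of topological spaces, with canonical projective limit $X, (p_n)_{n \in \mathbb N}$. If every $X_n$ is locally compact and sober, then $X$ is $\odot$-consonant and sober.
   Context: $\mathcal O X$ is the lattice of open subsets of $X$. A subset is saturated iff it is the intersection of its open neighborhoods. Compactness is the open cover property, with no separation axiom. A space is locally compact iff every point has a base of compact neighborhoods, and sober iff it is $T_0$ and every irreducible closed subset is the closure of a point. A space $X$ is consonant iff for every Scott-open subset $\mathcal U$ of $\mathcal O X$ (ordered by inclusion) and every $U \in \mathcal U$, there is a compact saturated subset $Q$ of $X$ such that $Q \subseteq U$ and every open neighborhood of $Q$ belongs to $\mathcal U$. $X$ is $\odot$-consonant iff for every $k \in \mathbb N$ the copower $k \odot X$, the topological sum of $k$ copies of $X$, is consonant. A projective system $(p_{mn} \colon X_n \to X_m)_{m \leq n \in \mathbb N}$ consists of spaces $X_n$ and continuous maps $p_{mn}$ ($m \leq n$) with $p_{nn} = \mathrm{id}$ and $p_{mn} \circ p_{nk} = p_{mk}$ for $m \leq n \leq k$. Its canonical projective limit is $X = \{\vec x \in \prod_{n} X_n \mid p_{mn}(x_n) = x_m \text{ for all } m \leq n\}$ with the subspace topology of the product, $p_n$ being projection onto coordinate $n$. *)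

theory Defs
  imports "HOL-Analysis.Analysis"
begin

definition saturated_in :: "'a topology \<Rightarrow> 'a set \<Rightarrow> bool" where
  "saturated_in X Q \<longleftrightarrow> Q \<subseteq> topspace X \<and> Q = \<Inter>{U. openin X U \<and> Q \<subseteq> U}"

(* This is stronger than the library's locally_compact_space, which only asks for one compact
   neighbourhood of each point; the two differ without the Hausdorff property. *)
definition locally_compact_base :: "'a topology \<Rightarrow> bool" where
  "locally_compact_base X \<longleftrightarrow> neighbourhood_base_of (compactin X) X"

definition irreducible_closed_in :: "'a topology \<Rightarrow> 'a set \<Rightarrow> bool" where
  "irreducible_closed_in X C \<longleftrightarrow> closedin X C \<and> C \<noteq> {} \<and>
     (\<forall>F G. closedin X F \<and> closedin X G \<and> C \<subseteq> F \<union> G \<longrightarrow> C \<subseteq> F \<or> C \<subseteq> G)"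

definition sober_space :: "'a topology \<Rightarrow> bool" where
  "sober_space X \<longleftrightarrow> t0_space X \<and>
     (\<forall>C. irreducible_closed_in X C \<longrightarrow> (\<exists>x \<in> topspace X. C = X closure_of {x}))"

definition directed_by_inclusion :: "'a set set \<Rightarrow> bool" where
  "directed_by_inclusion \<D> \<longleftrightarrow> \<D> \<noteq> {} \<and> (\<forall>A\<in>\<D>. \<forall>B\<in>\<D>. \<exists>C\<in>\<D>. A \<subseteq> C \<and> B \<subseteq> C)"

(* Scott-open subsets of the lattice of open sets of X; suprema in that lattice are unions. *)
definition scott_open_opens :: "'a topology \<Rightarrow> 'a set set \<Rightarrow> bool" where
  "scott_open_opens X \<U> \<longleftrightarrow>
     \<U> \<subseteq> Collect (openin X) \<and>
     (\<forall>U V. U \<in> \<U> \<and> openin X V \<and> U \<subseteq> V \<longrightarrow> V \<in> \<U>) \<and>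
     (\<forall>\<D>. \<D> \<subseteq> Collect (openin X) \<and> directed_by_inclusion \<D> \<and> \<Union>\<D> \<in> \<U> \<longrightarrow> \<D> \<inter> \<U> \<noteq> {})"

definition consonant_space :: "'a topology \<Rightarrow> bool" where
  "consonant_space X \<longleftrightarrow>
     (\<forall>\<U> U. scott_open_opens X \<U> \<and> U \<in> \<U> \<longrightarrow>
        (\<exists>Q. compactin X Q \<and> saturated_in X Q \<and> Q \<subseteq> U \<and>
             (\<forall>V. openin X V \<and> Q \<subseteq> V \<longrightarrow> V \<in> \<U>)))"

definition copower :: "nat \<Rightarrow> 'a topology \<Rightarrow> (nat \<times> 'a) topology" where
  "copower k X = sum_topology (\<lambda>_. X) {..<k}"

definition odot_consonant_space :: "'a topology \<Rightarrow> bool" where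
  "odot_consonant_space X \<longleftrightarrow> (\<forall>k. consonant_space (copower k X))"

(* p m n is the bonding map from X n to X m; only its values on topspace (X n) matter. *)
definition projective_system ::
  "(nat \<Rightarrow> 'a topology) \<Rightarrow> (nat \<Rightarrow> nat \<Rightarrow> 'a \<Rightarrow> 'a) \<Rightarrow> bool" where
  "projective_system X p \<longleftrightarrow>
     (\<forall>m n. m \<le> n \<longrightarrow> continuous_map (X n) (X m) (p m n)) \<and>
     (\<forall>n. \<forall>x \<in> topspace (X n). p n n x = x) \<and>
     (\<forall>m n k. m \<le> n \<and> n \<le> k \<longrightarrow> (\<forall>x \<in> topspace (X k). p m n (p n k x) = p m k x))"

definition projective_limit ::
  "(nat \<Rightarrow> 'a topology) \<Rightarrow> (nat \<Rightarrow> nat \<Rightarrow> 'a \<Rightarrow> 'a) \<Rightarrow> (nat \<Rightarrow> 'a) topology" where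
  "projective_limit X p =
     subtopology (product_topology X UNIV) {x. \<forall>m n. m \<le> n \<longrightarrow> p m n (x n) = x m}"

end

theory Submission
  imports Defs
begin

text \<open>
  Copowers commute with projective limits, and copowers of locally compact sober spaces are
  locally compact and sober. It therefore suffices to show that a projective limit \<open>L\<close> of
  locally compact sober spaces is consonant and sober (\<open>consonant_limit\<close>,
  \<open>sober_limit\<close>). Both are proved for any space that has the universal features of a
  limit (\<open>limit_cone\<close>), so that they apply directly to the copowers.

  For consonance, let \<open>\<U>\<close> be Scott-open and \<open>U \<in> \<U>\<close>. The set \<open>U\<close> is a
  directed union of preimages of open sets of the \<open>X n\<close>, so some such preimage belongs to
  \<open>\<U>\<close>. By local compactness every open set is the directed union of the interiors of its
  compact subsets, so one finds in it a compact saturated set whose interior still has its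
  preimage in \<open>\<U>\<close>. Repeating this one level higher inside the inverse image of that
  interior, and so on, gives compact saturated sets \<open>K n\<close> that the bonding maps send into
  one another. The desired compact saturated subset of \<open>L\<close> is the limit \<open>Q\<close> of the
  \<open>K n\<close>.

  The point is that every open \<open>W\<close> containing \<open>Q\<close> contains the preimage of some
  \<open>K m\<close> already, and hence belongs to \<open>\<U>\<close>; the same argument on covers gives
  compactness of \<open>Q\<close> (\<open>limit_of_compacts_finite_cover\<close>). This rests on a version of
  Steenrod's theorem (\<open>thread_in_compact_saturated\<close>): a compatible family of open sets, none
  of which contains its \<open>K n\<close>, is avoided by a whole thread of points of the \<open>K n\<close>.
  Sobriety of the \<open>X n\<close> enters there, to turn minimal closed sets into points.

  For sobriety, the closures of the projections of an irreducible closed set are irreducible,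
  and their generic points form a thread, which is the generic point sought.
\<close>

section \<open>Projective systems and saturated sets\<close>

lemma projective_systemD:
  assumes "projective_system X p"
  shows "m \<le> n \<Longrightarrow> continuous_map (X n) (X m) (p m n)"
    and "x \<in> topspace (X n) \<Longrightarrow> p n n x = x"
    and "\<lbrakk>m \<le> n; n \<le> k; x \<in> topspace (X k)\<rbrakk> \<Longrightarrow> p m n (p n k x) = p m k x"
    and "\<lbrakk>m \<le> n; x \<in> topspace (X n)\<rbrakk> \<Longrightarrow> p m n x \<in> topspace (X m)"
    and "\<lbrakk>m \<le> n; openin (X m) V\<rbrakk> \<Longrightarrow> openin (X n) {x \<in> topspace (X n). p m n x \<in> V}"
proof -
  show cont: "continuous_map (X n) (X m) (p m n)" if "m \<le> n" for m n
    using assms that by (simp add: projective_system_def)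
  show "x \<in> topspace (X n) \<Longrightarrow> p n n x = x"
    and "\<lbrakk>m \<le> n; n \<le> k; x \<in> topspace (X k)\<rbrakk> \<Longrightarrow> p m n (p n k x) = p m k x"
    using assms by (auto simp: projective_system_def)
  show "\<lbrakk>m \<le> n; x \<in> topspace (X n)\<rbrakk> \<Longrightarrow> p m n x \<in> topspace (X m)"
    using cont by (auto simp: continuous_map_def)
  show "\<lbrakk>m \<le> n; openin (X m) V\<rbrakk> \<Longrightarrow> openin (X n) {x \<in> topspace (X n). p m n x \<in> V}"
    using cont openin_continuous_map_preimage by blast
qed

lemma t0_closure_sing_inject:
  assumes "t0_space X" "x \<in> topspace X" "y \<in> topspace X"
    and "X closure_of {x} = X closure_of {y}"
  shows "x = y"
  using assms unfolding t0_space_closure_of_sing by blast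

lemma saturated_inI:
  assumes "Q \<subseteq> topspace X"
    and "\<And>y. \<lbrakk>y \<in> topspace X; y \<notin> Q\<rbrakk> \<Longrightarrow> \<exists>U. openin X U \<and> Q \<subseteq> U \<and> y \<notin> U"
  shows "saturated_in X Q"
  unfolding saturated_in_def
proof
  have "x \<in> Q" if "x \<in> \<Inter>{U. openin X U \<and> Q \<subseteq> U}" for x
    using that assms openin_topspace[of X] by blast
  then show "Q = \<Inter>{U. openin X U \<and> Q \<subseteq> U}" by blast
qed (fact assms)

lemma saturated_inE:
  assumes "saturated_in X Q" "y \<notin> Q"
  obtains U where "openin X U" "Q \<subseteq> U" "y \<notin> U"
proof -
  have "Q = \<Inter>{U. openin X U \<and> Q \<subseteq> U}"
    using assms by (simp add: saturated_in_def)
  with \<open>y \<notin> Q\<close> have "y \<notin> \<Inter>{U. openin X U \<and> Q \<subseteq> U}"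
    by simp
  then show ?thesis using that by blast
qed

text \<open>
  A set and its saturation have the same open neighbourhoods, hence saturating preserves
  compactness and does not leave an open set.
\<close>

lemma compact_saturation:
  assumes "compactin X K" "openin X V" "K \<subseteq> V"
  obtains Q where "compactin X Q" "saturated_in X Q" "K \<subseteq> Q" "Q \<subseteq> V"
proof -
  define Q where "Q = \<Inter>{U. openin X U \<and> K \<subseteq> U}"
  have K: "K \<subseteq> topspace X" using assms by (simp add: compactin_def)
  have sub: "Q \<subseteq> U" if "openin X U" "K \<subseteq> U" for U
    using that by (auto simp: Q_def)
  have KQ: "K \<subseteq> Q" by (auto simp: Q_def)
  have "\<exists>U. openin X U \<and> Q \<subseteq> U \<and> y \<notin> U" if "y \<notin> Q" for y
  proof -
    obtain U where "openin X U" "K \<subseteq> U" "y \<notin> U" using \<open>y \<notin> Q\<close> unfolding Q_def by blast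
    then show ?thesis using sub by blast
  qed
  then have sat: "saturated_in X Q"
    using sub[OF openin_topspace K] by (intro saturated_inI) simp_all
  have "\<exists>\<F>. finite \<F> \<and> \<F> \<subseteq> \<U> \<and> Q \<subseteq> \<Union>\<F>"
    if \<U>: "\<forall>U\<in>\<U>. openin X U" "Q \<subseteq> \<Union>\<U>" for \<U>
  proof -
    have "K \<subseteq> \<Union>\<U>" using \<U> KQ by simp
    then obtain \<F> where \<F>: "finite \<F>" "\<F> \<subseteq> \<U>" "K \<subseteq> \<Union>\<F>"
      using \<open>compactin X K\<close> \<U> unfolding compactin_def by meson
    moreover have "openin X (\<Union>\<F>)" using \<F> \<U> by blast
    ultimately show ?thesis using sub by meson
  qed
  then have "compactin X Q"
    using sub[OF openin_topspace K] unfolding compactin_def by simp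
  then show ?thesis using that sat KQ sub[OF assms(2,3)] by blast
qed

section \<open>Steenrod's theorem for compact saturated sets in sober spaces\<close>

text \<open>
  By compactness, Zorn's lemma enlarges the \<open>V n\<close> to a maximal compatible family of open
  sets none of which covers its compact set. Maximality makes the complements \<open>C n\<close>
  irreducible, and sobriety gives them generic points, which form the thread: each lies in
  the saturated set \<open>K n\<close> because \<open>C n\<close> meets \<open>K n\<close>. Families are encoded as sets of pairs, so
  that the componentwise order is plain inclusion.
\<close>

lemma thread_in_compact_saturated:
  fixes X :: "nat \<Rightarrow> 'a topology"
  assumes sys: "projective_system X p"
    and sober: "\<And>n. sober_space (X n)"
    and cpt: "\<And>n. compactin (X n) (K n)"
    and sat: "\<And>n. saturated_in (X n) (K n)"
    and KK: "\<And>m n. m \<le> n \<Longrightarrow> p m n ` K n \<subseteq> K m"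
    and opn: "\<And>n. openin (X n) (V n)"
    and VV: "\<And>m n. m \<le> n \<Longrightarrow> {x \<in> topspace (X n). p m n x \<in> V m} \<subseteq> V n"
    and nsub: "\<And>n. \<not> K n \<subseteq> V n"
  obtains x where "\<And>n. x n \<in> K n - V n" "\<And>m n. m \<le> n \<Longrightarrow> p m n (x n) = x m"
proof -
  note D = projective_systemD[OF sys]
  have KT: "K n \<subseteq> topspace (X n)" for n using cpt by (simp add: compactin_def)
  define P where "P W \<longleftrightarrow> (\<forall>n. openin (X n) (W``{n})) \<and>
      (\<forall>m n. m \<le> n \<longrightarrow> {x \<in> topspace (X n). p m n x \<in> W``{m}} \<subseteq> W``{n}) \<and>
      (\<forall>n. \<not> K n \<subseteq> W``{n})" for W :: "(nat \<times> 'a) set"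
  define V0 where "V0 = Sigma UNIV V"
  have V0n: "V0``{n} = V n" for n by (auto simp: V0_def)
  have "\<exists>M\<in>{W. P W \<and> V0 \<subseteq> W}. \<forall>W\<in>{W. P W \<and> V0 \<subseteq> W}. M \<subseteq> W \<longrightarrow> W = M"
  proof (rule subset_Zorn_nonempty)
    have "P V0" using opn VV nsub unfolding P_def V0n by blast
    then show "{W. P W \<and> V0 \<subseteq> W} \<noteq> {}" by blast
    fix \<C> assume ne: "\<C> \<noteq> {}" and "subset.chain {W. P W \<and> V0 \<subseteq> W} \<C>"
    then have inP: "P W" "V0 \<subseteq> W" if "W \<in> \<C>" for W
      using that by (auto simp: subset.chain_def)
    have chain: "W \<subseteq> W' \<or> W' \<subseteq> W" if "W \<in> \<C>" "W' \<in> \<C>" for W W'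
      using \<open>subset.chain _ \<C>\<close> that unfolding subset.chain_def by blast
    have Un: "(\<Union>\<C>)``{n} = (\<Union>W\<in>\<C>. W``{n})" for n by blast
    have "\<not> K n \<subseteq> (\<Union>\<C>)``{n}" for n
    proof
      assume "K n \<subseteq> (\<Union>\<C>)``{n}"
      then have "K n \<subseteq> \<Union>((\<lambda>W. W``{n}) ` \<C>)" by blast
      moreover have "\<forall>U \<in> (\<lambda>W. W``{n}) ` \<C>. openin (X n) U"
        using inP by (auto simp: P_def)
      ultimately obtain \<F> where \<F>: "finite \<F>" "\<F> \<subseteq> (\<lambda>W. W``{n}) ` \<C>" "K n \<subseteq> \<Union>\<F>"
        using cpt[of n] unfolding compactin_def by meson
      then obtain \<G> where \<G>: "finite \<G>" "\<G> \<subseteq> \<C>" "\<F> = (\<lambda>W. W``{n}) ` \<G>"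
        by (meson finite_subset_image)
      have "\<exists>W\<in>\<C>. \<Union>\<G> \<subseteq> W"
        using \<G>(1,2)
      proof (induction \<G>)
        case empty
        then show ?case using ne by blast
      next
        case (insert A \<G>)
        have "A \<in> \<C>" "\<G> \<subseteq> \<C>" using insert.prems by simp_all
        obtain W where "W \<in> \<C>" "\<Union>\<G> \<subseteq> W" using insert.IH[OF \<open>\<G> \<subseteq> \<C>\<close>] by (elim bexE)
        have "A \<subseteq> W \<or> W \<subseteq> A" using chain[OF \<open>A \<in> \<C>\<close> \<open>W \<in> \<C>\<close>] .
        then show ?case
        proof (elim disjE)
          assume "A \<subseteq> W"
          then have "\<Union>(insert A \<G>) \<subseteq> W" using \<open>\<Union>\<G> \<subseteq> W\<close> by simp
          then show ?thesis using \<open>W \<in> \<C>\<close> by blast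
        next
          assume "W \<subseteq> A"
          then have "\<Union>(insert A \<G>) \<subseteq> A" using \<open>\<Union>\<G> \<subseteq> W\<close> by auto
          then show ?thesis using \<open>A \<in> \<C>\<close> by blast
        qed
      qed
      then obtain W where "W \<in> \<C>" "\<Union>\<G> \<subseteq> W" by (elim bexE)
      then have "K n \<subseteq> W``{n}" using \<F>(3) \<G>(3) by blast
      then show False using inP(1)[OF \<open>W \<in> \<C>\<close>] by (simp add: P_def)
    qed
    moreover have "openin (X n) ((\<Union>\<C>)``{n})" for n
      unfolding Un using inP by (auto simp: P_def)
    moreover have "{x \<in> topspace (X n). p m n x \<in> (\<Union>\<C>)``{m}} \<subseteq> (\<Union>\<C>)``{n}"
      if "m \<le> n" for m n
    proof
      fix x assume x: "x \<in> {x \<in> topspace (X n). p m n x \<in> (\<Union>\<C>)``{m}}"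
      then obtain W where "W \<in> \<C>" "p m n x \<in> W``{m}" by blast
      then have "x \<in> W``{n}" using inP(1)[OF \<open>W \<in> \<C>\<close>] x that unfolding P_def by blast
      then show "x \<in> (\<Union>\<C>)``{n}" using \<open>W \<in> \<C>\<close> by blast
    qed
    ultimately have "P (\<Union>\<C>)" by (simp add: P_def)
    moreover have "V0 \<subseteq> \<Union>\<C>" using ne inP(2) by blast
    ultimately show "\<Union>\<C> \<in> {W. P W \<and> V0 \<subseteq> W}" by blast
  qed
  then obtain M where M: "M \<in> {W. P W \<and> V0 \<subseteq> W}"
    and M_max: "\<forall>W\<in>{W. P W \<and> V0 \<subseteq> W}. M \<subseteq> W \<longrightarrow> W = M"
    by (elim bexE)
  have PM: "P M" and V0M: "V0 \<subseteq> M" using M by simp_all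
  have max: "W = M" if "P W" "M \<subseteq> W" for W
    using M_max that order_trans[OF V0M \<open>M \<subseteq> W\<close>] by simp
  have M_open: "openin (X n) (M``{n})" and M_nsub: "\<not> K n \<subseteq> M``{n}" for n
    using PM by (simp_all add: P_def)
  have M_pull: "x \<in> M``{n}" if "m \<le> n" "x \<in> topspace (X n)" "p m n x \<in> M``{m}" for m n x
    using PM that unfolding P_def by blast
  define C where "C n = topspace (X n) - M``{n}" for n
  have C_top: "C n \<subseteq> topspace (X n)" for n by (auto simp: C_def)
  have C_closed: "closedin (X n) (C n)" for n
    unfolding C_def by (intro closedin_diff closedin_topspace M_open)
  have CK: "\<exists>y. y \<in> K n \<and> y \<in> C n" for n
    using M_nsub[of n] KT[of n] by (auto simp: C_def)
  have pC: "p m n y \<in> C m" if "m \<le> n" "y \<in> C n" for m n y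
    using that M_pull D(4) by (auto simp: C_def)
  \<comment> \<open>Maximality: removing from \<open>C n\<close> the points outside a closed \<open>F\<close>, and pulling this
    back to all later levels, must empty one of the compact sets.\<close>
  have escape: "\<exists>k\<ge>n. \<forall>y \<in> K k \<inter> C k. p n k y \<notin> F"
    if F: "closedin (X n) F" and nF: "\<not> C n \<subseteq> F" for n F
  proof -
    define W where "W = M \<union> {(k, y). n \<le> k \<and> y \<in> topspace (X k) \<and> p n k y \<in> topspace (X n) - F}"
    have Wk: "W``{k} = M``{k} \<union>
        (if n \<le> k then {y \<in> topspace (X k). p n k y \<in> topspace (X n) - F} else {})" for k
      by (auto simp: W_def)
    have "W \<noteq> M"
    proof -
      obtain a where "a \<in> C n" "a \<notin> F" using nF by blast
      then have "a \<in> W``{n}" "a \<notin> M``{n}"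
        using D(2) by (auto simp: C_def Wk)
      then show ?thesis by blast
    qed
    then have "\<not> P W" using max[of W] by (auto simp: W_def)
    moreover have "openin (X k) (W``{k})" for k
      unfolding Wk using M_open F D(5)[of n k "topspace (X n) - F"]
      by (auto intro: openin_Un)
    moreover have "{y \<in> topspace (X b). p a b y \<in> W``{a}} \<subseteq> W``{b}" if "a \<le> b" for a b
    proof
      fix y assume y: "y \<in> {y \<in> topspace (X b). p a b y \<in> W``{a}}"
      show "y \<in> W``{b}"
      proof (cases "p a b y \<in> M``{a}")
        case True
        then show ?thesis using M_pull that y unfolding Wk by blast
      next
        case False
        then have "n \<le> a" "p n a (p a b y) \<in> topspace (X n) - F"
          using y unfolding Wk by (auto split: if_splits)
        then show ?thesis using D(3)[of n a b y] that y unfolding Wk by auto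
      qed
    qed
    ultimately obtain k where k: "K k \<subseteq> W``{k}" unfolding P_def by blast
    then have "n \<le> k" using M_nsub[of k] unfolding Wk by (auto split: if_splits)
    moreover have "p n k y \<notin> F" if "y \<in> K k \<inter> C k" for y
      using that k \<open>n \<le> k\<close> unfolding Wk C_def by auto
    ultimately show ?thesis by blast
  qed
  \<comment> \<open>Bonding maps carry \<open>K l \<inter> C l\<close> into \<open>K k \<inter> C k\<close>, so what holds at one level
    persists above it. Two such facts can therefore be compared at a common level.\<close>
  have up: "\<forall>y \<in> K l \<inter> C l. p n l y \<notin> F"
    if "n \<le> k" "k \<le> l" "\<forall>y \<in> K k \<inter> C k. p n k y \<notin> F" for n k l F
  proof
    fix y assume y: "y \<in> K l \<inter> C l"
    then have "p k l y \<in> K k \<inter> C k" using KK[OF that(2)] pC[OF that(2)] by blast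
    moreover have "p n k (p k l y) = p n l y"
      using D(3)[of n k l y] that(1,2) y C_top by blast
    ultimately show "p n l y \<notin> F" using that(3) by metis
  qed
  have irr: "irreducible_closed_in (X n) (C n)" for n
    unfolding irreducible_closed_in_def
  proof (intro conjI allI impI)
    show "closedin (X n) (C n)" by fact
    show "C n \<noteq> {}" using CK by blast
    fix F G assume FG: "closedin (X n) F \<and> closedin (X n) G \<and> C n \<subseteq> F \<union> G"
    show "C n \<subseteq> F \<or> C n \<subseteq> G"
    proof (rule ccontr)
      assume "\<not> (C n \<subseteq> F \<or> C n \<subseteq> G)"
      then obtain k l where k: "k \<ge> n" "\<forall>y \<in> K k \<inter> C k. p n k y \<notin> F"
        and l: "l \<ge> n" "\<forall>y \<in> K l \<inter> C l. p n l y \<notin> G"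
        using escape FG by meson
      obtain y where y: "y \<in> K (max k l)" "y \<in> C (max k l)" using CK by blast
      have "p n (max k l) y \<notin> F" using up[of n k "max k l"] k y by auto
      moreover have "p n (max k l) y \<notin> G" using up[of n l "max k l"] l y by auto
      moreover have "p n (max k l) y \<in> C n" using pC[of n "max k l" y] y k by auto
      ultimately show False using FG by blast
    qed
  qed
  then have "\<exists>x \<in> topspace (X n). C n = X n closure_of {x}" for n
    using sober unfolding sober_space_def by blast
  then obtain x where xT: "\<And>n. x n \<in> topspace (X n)"
    and x: "\<And>n. C n = X n closure_of {x n}" by metis
  have xC: "x n \<in> C n" for n
    using xT x closure_of_subset[of "{x n}" "X n"] by auto
  show ?thesis
  proof
    show "x n \<in> K n - V n" for n
    proof
      show "x n \<notin> V n" using xC[of n] V0M unfolding C_def V0_def by blast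
      show "x n \<in> K n"
      proof (rule ccontr)
        assume "x n \<notin> K n"
        then obtain U where U: "openin (X n) U" "K n \<subseteq> U" "x n \<notin> U"
          using sat saturated_inE by metis
        obtain y where "y \<in> K n" "y \<in> C n" using CK by blast
        then show False using U x[of n] by (auto simp: in_closure_of)
      qed
    qed
  next
    fix m n :: nat assume mn: "m \<le> n"
    \<comment> \<open>It is enough that \<open>p m n (x n)\<close> is another generic point of \<open>C m\<close>.\<close>
    define F where "F = X m closure_of {p m n (x n)}"
    have "C m \<subseteq> F"
    proof (rule ccontr)
      assume "\<not> C m \<subseteq> F"
      then obtain k where k: "k \<ge> m" "\<forall>y \<in> K k \<inter> C k. p m k y \<notin> F"
        using escape[of m F] by (auto simp: F_def)
      define l where "l = max k n"
      obtain y where y: "y \<in> K l" "y \<in> C l" using CK by blast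
      have "p n l y \<in> X n closure_of {x n}" using pC[of n l y] y x by (auto simp: l_def)
      then have "p m n (p n l y) \<in> F"
        using continuous_map_image_closure_subset[OF D(1)[OF mn], of "{x n}"]
        by (auto simp: F_def)
      moreover have "p m n (p n l y) = p m l y"
        using D(3)[of m n l y] mn y(2) C_top[of l] by (auto simp: l_def)
      ultimately have "p m l y \<in> F" by simp
      then show False using up[of m k l F] k y by (auto simp: l_def)
    qed
    moreover have "F \<subseteq> C m"
      unfolding F_def using pC[OF mn xC] C_closed by (simp add: closure_of_minimal)
    ultimately have "X m closure_of {p m n (x n)} = X m closure_of {x m}"
      using x[of m] by (simp add: F_def)
    then show "p m n (x n) = x m"
      using t0_closure_sing_inject[of "X m"] sober xT D(4)[OF mn]
      by (simp add: sober_space_def)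
  qed
qed

section \<open>Limits of projective systems up to homeomorphism\<close>

text \<open>
  A characterisation of the limit cones over a system: the projections are continuous,
  compatible and jointly injective, every thread comes from a point, and the preimages of
  open sets form a base. It makes the arguments applicable to the copowers of a projective
  limit, whose points are not threads themselves.
\<close>

definition limit_cone ::
  "(nat \<Rightarrow> 'a topology) \<Rightarrow> (nat \<Rightarrow> nat \<Rightarrow> 'a \<Rightarrow> 'a) \<Rightarrow> 'b topology \<Rightarrow> (nat \<Rightarrow> 'b \<Rightarrow> 'a) \<Rightarrow> bool"
  where
  "limit_cone X p L \<pi> \<longleftrightarrow>
     (\<forall>n. continuous_map L (X n) (\<pi> n)) \<and>
     (\<forall>m n. \<forall>y \<in> topspace L. m \<le> n \<longrightarrow> p m n (\<pi> n y) = \<pi> m y) \<and>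
     (\<forall>y \<in> topspace L. \<forall>z \<in> topspace L. (\<forall>n. \<pi> n y = \<pi> n z) \<longrightarrow> y = z) \<and>
     (\<forall>x. (\<forall>n. x n \<in> topspace (X n)) \<and> (\<forall>m n. m \<le> n \<longrightarrow> p m n (x n) = x m) \<longrightarrow>
        (\<exists>y \<in> topspace L. \<forall>n. \<pi> n y = x n)) \<and>
     (\<forall>U y. openin L U \<and> y \<in> U \<longrightarrow>
        (\<exists>n V. openin (X n) V \<and> \<pi> n y \<in> V \<and> {z \<in> topspace L. \<pi> n z \<in> V} \<subseteq> U))"

lemma limit_coneD:
  assumes "limit_cone X p L \<pi>"
  shows "continuous_map L (X n) (\<pi> n)"
    and "\<lbrakk>m \<le> n; y \<in> topspace L\<rbrakk> \<Longrightarrow> p m n (\<pi> n y) = \<pi> m y"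
    and "\<lbrakk>y \<in> topspace L; z \<in> topspace L; \<And>n. \<pi> n y = \<pi> n z\<rbrakk> \<Longrightarrow> y = z"
    and "y \<in> topspace L \<Longrightarrow> \<pi> n y \<in> topspace (X n)"
    and "openin (X n) V \<Longrightarrow> openin L {y \<in> topspace L. \<pi> n y \<in> V}"
proof -
  note cone = assms[unfolded limit_cone_def]
  show cont: "continuous_map L (X n) (\<pi> n)" for n
    using cone[THEN conjunct1] by (rule spec)
  show "\<lbrakk>m \<le> n; y \<in> topspace L\<rbrakk> \<Longrightarrow> p m n (\<pi> n y) = \<pi> m y"
    using cone[THEN conjunct2, THEN conjunct1] by blast
  show "\<lbrakk>y \<in> topspace L; z \<in> topspace L; \<And>n. \<pi> n y = \<pi> n z\<rbrakk> \<Longrightarrow> y = z"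
    using cone[THEN conjunct2, THEN conjunct2, THEN conjunct1] by blast
  show "y \<in> topspace L \<Longrightarrow> \<pi> n y \<in> topspace (X n)"
    using cont[of n] by (auto simp: continuous_map_def)
  show "openin (X n) V \<Longrightarrow> openin L {y \<in> topspace L. \<pi> n y \<in> V}"
    by (rule openin_continuous_map_preimage[OF cont])
qed

lemma limit_cone_lift:
  assumes "limit_cone X p L \<pi>"
    and "\<And>n. x n \<in> topspace (X n)" "\<And>m n. m \<le> n \<Longrightarrow> p m n (x n) = x m"
  obtains y where "y \<in> topspace L" "\<And>n. \<pi> n y = x n"
proof -
  have "\<exists>y \<in> topspace L. \<forall>n. \<pi> n y = x n"
    using assms(1)[unfolded limit_cone_def, THEN conjunct2, THEN conjunct2, THEN conjunct2,
        THEN conjunct1, THEN spec[of _ x]] assms(2,3) by blast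
  then show ?thesis using that by blast
qed

lemma limit_cone_basis:
  assumes "limit_cone X p L \<pi>" "openin L U" "y \<in> U"
  obtains n V where "openin (X n) V" "\<pi> n y \<in> V" "{z \<in> topspace L. \<pi> n z \<in> V} \<subseteq> U"
proof -
  have "\<exists>n V. openin (X n) V \<and> \<pi> n y \<in> V \<and> {z \<in> topspace L. \<pi> n z \<in> V} \<subseteq> U"
    using assms(1)[unfolded limit_cone_def, THEN conjunct2, THEN conjunct2, THEN conjunct2,
        THEN conjunct2, THEN spec[of _ U], THEN spec[of _ y]] assms(2,3) by blast
  then show ?thesis using that by (elim exE conjE)
qed

text \<open>
  Any neighbourhood of the limit of the \<open>K n\<close> already absorbs the preimage of a single
  \<open>K m\<close>, and a cover needs finitely many members for it: a failure at every level would
  produce, by Steenrod's theorem, a thread in all \<open>K n\<close> outside the cover.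
\<close>

lemma limit_of_compacts_finite_cover:
  fixes X :: "nat \<Rightarrow> 'a topology"
  assumes sys: "projective_system X p" and cone: "limit_cone X p L \<pi>"
    and sober: "\<And>n. sober_space (X n)"
    and cpt: "\<And>n. compactin (X n) (K n)"
    and sat: "\<And>n. saturated_in (X n) (K n)"
    and KK: "\<And>m n. m \<le> n \<Longrightarrow> p m n ` K n \<subseteq> K m"
    and opn: "\<And>U. U \<in> \<O> \<Longrightarrow> openin L U"
    and cover: "{y \<in> topspace L. \<forall>n. \<pi> n y \<in> K n} \<subseteq> \<Union>\<O>"
  obtains m \<F> where "finite \<F>" "\<F> \<subseteq> \<O>" "{y \<in> topspace L. \<pi> m y \<in> K m} \<subseteq> \<Union>\<F>"
proof -
  note D = projective_systemD[OF sys] and E = limit_coneD[OF cone]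
  define \<B> where "\<B> n = {V. openin (X n) V \<and>
      (\<exists>U\<in>\<O>. {y \<in> topspace L. \<pi> n y \<in> V} \<subseteq> U)}" for n
  have \<B>_open: "openin (X n) (\<Union>(\<B> n))" for n
    by (intro openin_Union) (simp add: \<B>_def)
  have pull: "{x \<in> topspace (X n). p m n x \<in> \<Union>(\<B> m)} \<subseteq> \<Union>(\<B> n)" if "m \<le> n" for m n
  proof
    fix x assume x: "x \<in> {x \<in> topspace (X n). p m n x \<in> \<Union>(\<B> m)}"
    then obtain V where V: "V \<in> \<B> m" "p m n x \<in> V" by auto
    then obtain U where U: "U \<in> \<O>" "{y \<in> topspace L. \<pi> m y \<in> V} \<subseteq> U" "openin (X m) V"
      by (auto simp: \<B>_def)
    define V' where "V' = {x \<in> topspace (X n). p m n x \<in> V}"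
    have "{y \<in> topspace L. \<pi> n y \<in> V'} \<subseteq> U"
      using U(2) E(2)[OF that] by (auto simp: V'_def)
    then have "V' \<in> \<B> n"
      using U D(5)[OF that U(3)] by (auto simp: \<B>_def V'_def)
    moreover have "x \<in> V'" using x V by (simp add: V'_def)
    ultimately show "x \<in> \<Union>(\<B> n)" by (rule UnionI)
  qed
  have "\<exists>m. K m \<subseteq> \<Union>(\<B> m)"
  proof (rule ccontr)
    assume "\<nexists>m. K m \<subseteq> \<Union>(\<B> m)"
    then have "\<not> K n \<subseteq> \<Union>(\<B> n)" for n by simp
    from thread_in_compact_saturated[of X p K "\<lambda>n. \<Union>(\<B> n)",
        OF sys sober cpt sat KK \<B>_open pull this]
    obtain x where x: "\<And>n. x n \<in> K n - \<Union>(\<B> n)" "\<And>m n. m \<le> n \<Longrightarrow> p m n (x n) = x m"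
      by metis
    have "x n \<in> topspace (X n)" for n using x(1)[of n] cpt[of n] by (auto simp: compactin_def)
    then obtain y where y: "y \<in> topspace L" "\<And>n. \<pi> n y = x n"
      using limit_cone_lift[OF cone, of x] x(2) by metis
    then have "y \<in> {y \<in> topspace L. \<forall>n. \<pi> n y \<in> K n}" using x(1) by simp
    then obtain U where "U \<in> \<O>" "y \<in> U" using cover by (meson UnionE subsetD)
    then obtain n V where "openin (X n) V" "\<pi> n y \<in> V" "{z \<in> topspace L. \<pi> n z \<in> V} \<subseteq> U"
      using limit_cone_basis[OF cone opn] by metis
    then have "V \<in> \<B> n" "x n \<in> V" using \<open>U \<in> \<O>\<close> y(2) by (auto simp: \<B>_def)
    then show False using x(1)[of n] by auto
  qed
  then obtain m where "K m \<subseteq> \<Union>(\<B> m)" by (elim exE)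
  moreover have "\<forall>V\<in>\<B> m. openin (X m) V" by (simp add: \<B>_def)
  ultimately obtain \<G> where \<G>: "finite \<G>" "\<G> \<subseteq> \<B> m" "K m \<subseteq> \<Union>\<G>"
    using cpt[of m] unfolding compactin_def by meson
  have "\<forall>V\<in>\<G>. \<exists>U\<in>\<O>. {y \<in> topspace L. \<pi> m y \<in> V} \<subseteq> U"
    using \<G>(2) by (auto simp: \<B>_def)
  then obtain u where u: "\<And>V. V \<in> \<G> \<Longrightarrow> u V \<in> \<O> \<and> {y \<in> topspace L. \<pi> m y \<in> V} \<subseteq> u V"
    by metis
  have covered: "{y \<in> topspace L. \<pi> m y \<in> K m} \<subseteq> \<Union>(u ` \<G>)"
  proof
    fix y assume y: "y \<in> {y \<in> topspace L. \<pi> m y \<in> K m}"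
    then obtain V where "V \<in> \<G>" "\<pi> m y \<in> V" using \<G>(3) by auto
    then show "y \<in> \<Union>(u ` \<G>)" using u[of V] y by auto
  qed
  have "u ` \<G> \<subseteq> \<O>" using u by (simp add: image_subset_iff)
  from that[OF finite_imageI[OF \<G>(1)] this covered] show ?thesis .
qed

section \<open>Consonance of limits\<close>

lemma scott_open_opensD:
  assumes "scott_open_opens X \<U>"
  shows "U \<in> \<U> \<Longrightarrow> openin X U"
    and "\<lbrakk>U \<in> \<U>; openin X V; U \<subseteq> V\<rbrakk> \<Longrightarrow> V \<in> \<U>"
    and "\<lbrakk>\<And>U. U \<in> \<D> \<Longrightarrow> openin X U; directed_by_inclusion \<D>; \<Union>\<D> \<in> \<U>\<rbrakk> \<Longrightarrow> \<exists>U\<in>\<D>. U \<in> \<U>"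
proof -
  note scott = assms[unfolded scott_open_opens_def]
  note opens = scott[THEN conjunct1] and up = scott[THEN conjunct2, THEN conjunct1]
    and dir = scott[THEN conjunct2, THEN conjunct2]
  show "U \<in> \<U> \<Longrightarrow> openin X U" using opens by auto
  show "\<lbrakk>U \<in> \<U>; openin X V; U \<subseteq> V\<rbrakk> \<Longrightarrow> V \<in> \<U>" using up by metis
  show "\<exists>U\<in>\<D>. U \<in> \<U>"
    if D: "\<And>U. U \<in> \<D> \<Longrightarrow> openin X U" "directed_by_inclusion \<D>" "\<Union>\<D> \<in> \<U>"
  proof -
    have "\<D> \<subseteq> Collect (openin X)" using D(1) by (simp add: subset_iff)
    then have "\<D> \<inter> \<U> \<noteq> {}" using dir D(2,3) by simp
    then show ?thesis by auto
  qed
qed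

text \<open>
  The preimages of open sets contained in \<open>U\<close> are closed under binary unions, because two of
  them can be written at a common level; so they form a directed family, and its union is
  \<open>U\<close>.
\<close>

lemma scott_open_contains_cylinder:
  assumes sys: "projective_system X p" and cone: "limit_cone X p L \<pi>"
    and \<U>: "scott_open_opens L \<U>" "U \<in> \<U>"
  obtains n V where "openin (X n) V" "{y \<in> topspace L. \<pi> n y \<in> V} \<subseteq> U"
    "{y \<in> topspace L. \<pi> n y \<in> V} \<in> \<U>"
proof -
  note D = projective_systemD[OF sys] and E = limit_coneD[OF cone]
  note S = scott_open_opensD[OF \<U>(1)]
  have Uo: "openin L U" using S(1) \<U>(2) .
  define cyl where "cyl n V = {y \<in> topspace L. \<pi> n y \<in> V}" for n V
  define \<D> where "\<D> = {cyl n V | n V. openin (X n) V \<and> cyl n V \<subseteq> U}"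
  have pull: "cyl m V = cyl n {x \<in> topspace (X n). p m n x \<in> V}" if "m \<le> n" for m n V
    using E(2)[OF that] E(4) by (auto simp: cyl_def)
  have "\<exists>C\<in>\<D>. A \<subseteq> C \<and> B \<subseteq> C" if AB: "A \<in> \<D>" "B \<in> \<D>" for A B
  proof -
    obtain m V n W where A: "A = cyl m V" "openin (X m) V" "A \<subseteq> U"
      and B: "B = cyl n W" "openin (X n) W" "B \<subseteq> U"
      using AB unfolding \<D>_def by blast
    define k where "k = max m n"
    have "A \<union> B = cyl k ({x \<in> topspace (X k). p m k x \<in> V} \<union> {x \<in> topspace (X k). p n k x \<in> W})"
      using pull[of m k V] pull[of n k W] A(1) B(1) by (auto simp: cyl_def k_def)
    moreover have "openin (X k) ({x \<in> topspace (X k). p m k x \<in> V} \<union> {x \<in> topspace (X k). p n k x \<in> W})"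
      using D(5)[of m k V] D(5)[of n k W] A B by (simp add: openin_Un k_def)
    moreover have "A \<union> B \<subseteq> U" using A B by simp
    ultimately have "A \<union> B \<in> \<D>" unfolding \<D>_def by auto
    then show ?thesis by auto
  qed
  moreover have "cyl 0 {} \<in> \<D>"
  proof -
    have "openin (X 0) {}" "cyl 0 {} \<subseteq> U" by (simp_all add: cyl_def)
    then show ?thesis unfolding \<D>_def by blast
  qed
  ultimately have "directed_by_inclusion \<D>" unfolding directed_by_inclusion_def by blast
  moreover have "openin L A" if "A \<in> \<D>" for A
    using that E(5) by (auto simp: \<D>_def cyl_def)
  moreover have "\<Union>\<D> = U"
  proof
    show "\<Union>\<D> \<subseteq> U" by (auto simp: \<D>_def)
    show "U \<subseteq> \<Union>\<D>"
    proof
      fix y assume "y \<in> U"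
      then obtain n V where V: "openin (X n) V" "\<pi> n y \<in> V" "cyl n V \<subseteq> U"
        using limit_cone_basis[OF cone Uo] by (metis cyl_def)
      then have "cyl n V \<in> \<D>" by (auto simp: \<D>_def)
      moreover have "y \<in> cyl n V"
        using V(2) \<open>y \<in> U\<close> openin_subset[OF Uo] by (auto simp: cyl_def)
      ultimately show "y \<in> \<Union>\<D>" by (rule UnionI)
    qed
  qed
  ultimately obtain A where "A \<in> \<D>" "A \<in> \<U>" using S(3)[of \<D>] \<U>(2) by auto
  then show ?thesis using that unfolding \<D>_def cyl_def by auto
qed

text \<open>
  Local compactness makes \<open>V\<close> the directed union of the open sets that lie in a compact
  subset of \<open>V\<close>, and Scott-openness selects one of them. Saturating the compact set keeps it
  inside \<open>V\<close>.
\<close>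

lemma scott_open_interpolate_compact:
  assumes lc: "locally_compact_base X"
    and cont: "continuous_map L X f"
    and \<U>: "scott_open_opens L \<U>"
    and V: "openin X V" "{y \<in> topspace L. f y \<in> V} \<in> \<U>"
  obtains K W where "compactin X K" "saturated_in X K" "openin X W" "W \<subseteq> K" "K \<subseteq> V"
    "{y \<in> topspace L. f y \<in> W} \<in> \<U>"
proof -
  note S = scott_open_opensD[OF \<U>(1)]
  define cyl where "cyl V = {y \<in> topspace L. f y \<in> V}" for V
  define \<W> where "\<W> = {W. openin X W \<and> (\<exists>K. compactin X K \<and> W \<subseteq> K \<and> K \<subseteq> V)}"
  have \<W>Un: "A \<union> B \<in> \<W>" if AB: "A \<in> \<W>" "B \<in> \<W>" for A B
  proof -
    obtain K K' where "compactin X K" "A \<subseteq> K" "K \<subseteq> V" "compactin X K'" "B \<subseteq> K'" "K' \<subseteq> V"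
      using AB by (auto simp: \<W>_def)
    then have "compactin X (K \<union> K')" "A \<union> B \<subseteq> K \<union> K'" "K \<union> K' \<subseteq> V"
      by (auto intro: compactin_Un)
    then show ?thesis using AB unfolding \<W>_def by blast
  qed
  have "\<exists>C\<in>cyl ` \<W>. A \<subseteq> C \<and> B \<subseteq> C" if AB: "A \<in> cyl ` \<W>" "B \<in> cyl ` \<W>" for A B
  proof -
    obtain A' B' where "A = cyl A'" "A' \<in> \<W>" "B = cyl B'" "B' \<in> \<W>" using AB by auto
    then have "cyl (A' \<union> B') \<in> cyl ` \<W>" "A \<subseteq> cyl (A' \<union> B')" "B \<subseteq> cyl (A' \<union> B')"
      using \<W>Un by (auto simp: cyl_def)
    then show ?thesis by blast
  qed
  moreover have "{} \<in> \<W>" by (auto simp: \<W>_def intro: exI[of _ "{}"])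
  ultimately have "directed_by_inclusion (cyl ` \<W>)" unfolding directed_by_inclusion_def by blast
  moreover have "openin L A" if "A \<in> cyl ` \<W>" for A
    using that openin_continuous_map_preimage[OF cont] by (auto simp: cyl_def \<W>_def)
  moreover have "\<Union>(cyl ` \<W>) = cyl V"
  proof -
    have "x \<in> \<Union>\<W>" if xV: "x \<in> V" for x
    proof -
      obtain W K where "openin X W" "compactin X K" "x \<in> W" "W \<subseteq> K" "K \<subseteq> V"
        using lc[unfolded locally_compact_base_def neighbourhood_base_of, rule_format, OF conjI, OF V(1) xV]
        by metis
      then have "W \<in> \<W>" unfolding \<W>_def by blast
      then show ?thesis using \<open>x \<in> W\<close> by (rule UnionI)
    qed
    moreover have "\<Union>\<W> \<subseteq> V" by (auto simp: \<W>_def)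
    ultimately have "\<Union>\<W> = V" by auto
    then show ?thesis by (auto simp: cyl_def)
  qed
  ultimately obtain W where "W \<in> \<W>" "cyl W \<in> \<U>"
    using S(3)[of "cyl ` \<W>"] V(2) by (auto simp: cyl_def)
  then obtain K where "openin X W" "compactin X K" "W \<subseteq> K" "K \<subseteq> V"
    by (auto simp: \<W>_def)
  then obtain Q where Q: "compactin X Q" "saturated_in X Q" "K \<subseteq> Q" "Q \<subseteq> V"
    using compact_saturation[of X K V] V(1) by metis
  show ?thesis
    using that[OF Q(1,2) \<open>openin X W\<close> order_trans[OF \<open>W \<subseteq> K\<close> Q(3)] Q(4)] \<open>cyl W \<in> \<U>\<close>
    by (simp add: cyl_def)
qed

lemma projective_system_tail:
  "projective_system X p \<Longrightarrow> projective_system (\<lambda>n. X (N + n)) (\<lambda>m n. p (N + m) (N + n))"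
  by (simp add: projective_system_def)

text \<open>
  A tail of the system has the same limit, since a thread on the tail extends downwards
  along the bonding maps. It lets a construction start at an arbitrary level.
\<close>

lemma limit_cone_tail:
  assumes sys: "projective_system X p" and cone: "limit_cone X p L \<pi>"
  shows "limit_cone (\<lambda>n. X (N + n)) (\<lambda>m n. p (N + m) (N + n)) L (\<lambda>n. \<pi> (N + n))"
proof -
  note D = projective_systemD[OF sys] and E = limit_coneD[OF cone]
  have inj: "y = z"
    if yz: "y \<in> topspace L" "z \<in> topspace L" "\<And>n. \<pi> (N + n) y = \<pi> (N + n) z" for y z
  proof (rule E(3)[OF yz(1,2)])
    show "\<pi> n y = \<pi> n z" for n
      using E(2)[of n "N + n" y] E(2)[of n "N + n" z] yz by simp
  qed
  have lift: "\<exists>y \<in> topspace L. \<forall>n. \<pi> (N + n) y = x n"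
    if x: "\<And>n. x n \<in> topspace (X (N + n))" "\<And>m n. m \<le> n \<Longrightarrow> p (N + m) (N + n) (x n) = x m"
    for x
  proof -
    define x' where "x' n = p n (N + n) (x n)" for n
    have x'N: "x' (N + n) = x n" for n
      using x(2)[of n "N + n"] by (simp add: x'_def)
    have "x' n \<in> topspace (X n)" for n
      using x(1)[of n] D(4)[of n "N + n"] by (simp add: x'_def)
    moreover have "p m n (x' n) = x' m" if "m \<le> n" for m n
    proof -
      have "p m n (x' n) = p m (N + n) (x n)"
        unfolding x'_def using D(3)[of m n "N + n" "x n"] that x(1) by simp
      also have "\<dots> = p m (N + m) (p (N + m) (N + n) (x n))"
        using D(3)[of m "N + m" "N + n" "x n"] that x(1) by simp
      also have "\<dots> = x' m"
        using x(2)[OF that] by (simp add: x'_def)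
      finally show ?thesis .
    qed
    ultimately obtain y where "y \<in> topspace L" "\<And>n. \<pi> n y = x' n"
      using limit_cone_lift[OF cone] by metis
    then show ?thesis using x'N by (intro bexI[of _ y]) simp_all
  qed
  have basis: "\<exists>n V. openin (X (N + n)) V \<and> \<pi> (N + n) y \<in> V \<and> {z \<in> topspace L. \<pi> (N + n) z \<in> V} \<subseteq> U"
    if U: "openin L U" "y \<in> U" for U y
  proof -
    obtain n V where V: "openin (X n) V" "\<pi> n y \<in> V" "{z \<in> topspace L. \<pi> n z \<in> V} \<subseteq> U"
      using limit_cone_basis[OF cone U] .
    have "y \<in> topspace L" using U openin_subset by auto
    have eq: "\<pi> (N + n) z \<in> {x \<in> topspace (X (N + n)). p n (N + n) x \<in> V} \<longleftrightarrow> \<pi> n z \<in> V"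
      if "z \<in> topspace L" for z
      using E(2)[of n "N + n" z] E(4)[of z "N + n"] that by simp
    then have "{z \<in> topspace L. \<pi> (N + n) z \<in> {x \<in> topspace (X (N + n)). p n (N + n) x \<in> V}} \<subseteq> U"
      using V(3) by blast
    moreover have "openin (X (N + n)) {x \<in> topspace (X (N + n)). p n (N + n) x \<in> V}"
      using V(1) by (intro D(5)) simp_all
    moreover have "\<pi> (N + n) y \<in> {x \<in> topspace (X (N + n)). p n (N + n) x \<in> V}"
      using eq[OF \<open>y \<in> topspace L\<close>] V(2) by (rule iffD2)
    ultimately show ?thesis by (intro exI conjI)
  qed
  show ?thesis
    unfolding limit_cone_def
  proof (intro conjI allI impI ballI)
    show "continuous_map L (X (N + n)) (\<pi> (N + n))" for n by (rule E(1))
    show "p (N + m) (N + n) (\<pi> (N + n) y) = \<pi> (N + m) y"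
      if "y \<in> topspace L" "m \<le> n" for m n y
      using that by (intro E(2)) simp_all
    show "y = z" if "y \<in> topspace L" "z \<in> topspace L" "\<forall>n. \<pi> (N + n) y = \<pi> (N + n) z" for y z
      using inj[OF that(1,2)] that(3) by simp
    show "\<exists>y \<in> topspace L. \<forall>n. \<pi> (N + n) y = x n"
      if "(\<forall>n. x n \<in> topspace (X (N + n))) \<and>
        (\<forall>m n. m \<le> n \<longrightarrow> p (N + m) (N + n) (x n) = x m)" for x
      using that by (intro lift) simp_all
    show "\<exists>n V. openin (X (N + n)) V \<and> \<pi> (N + n) y \<in> V \<and>
        {z \<in> topspace L. \<pi> (N + n) z \<in> V} \<subseteq> U" if "openin L U \<and> y \<in> U" for U y
      using that by (intro basis) simp_all
  qed
qed

text \<open>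
  Iterated interpolation yields compact saturated sets \<open>K n\<close> and open \<open>W n \<subseteq> K n\<close> with
  preimage in \<open>\<U>\<close>, where \<open>K (Suc n)\<close> is mapped into \<open>W n\<close>. The set \<open>Q\<close> is the limit of the
  \<open>K n\<close>: an open neighbourhood of \<open>Q\<close> contains the preimage of some \<open>K m\<close>, hence that of
  \<open>W m\<close>.
\<close>

lemma scott_open_compact_saturated_below:
  fixes X :: "nat \<Rightarrow> 'a topology"
  assumes sys: "projective_system X p" and cone: "limit_cone X p L \<pi>"
    and lc: "\<And>n. locally_compact_base (X n)"
    and sober: "\<And>n. sober_space (X n)"
    and \<U>: "scott_open_opens L \<U>"
    and V: "openin (X 0) V" "{y \<in> topspace L. \<pi> 0 y \<in> V} \<in> \<U>"
  obtains Q where "compactin L Q" "saturated_in L Q" "Q \<subseteq> {y \<in> topspace L. \<pi> 0 y \<in> V}"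
    "\<And>W. \<lbrakk>openin L W; Q \<subseteq> W\<rbrakk> \<Longrightarrow> W \<in> \<U>"
proof -
  note D = projective_systemD[OF sys] and E = limit_coneD[OF cone]
  note S = scott_open_opensD[OF \<U>(1)]
  define good where "good n = (\<lambda>(K, W). compactin (X n) K \<and> saturated_in (X n) K \<and>
      openin (X n) W \<and> W \<subseteq> K \<and> {y \<in> topspace L. \<pi> n y \<in> W} \<in> \<U> \<and> (n = 0 \<longrightarrow> K \<subseteq> V))" for n
  have "\<exists>f. \<forall>n. good n (f n) \<and> p n (Suc n) ` fst (f (Suc n)) \<subseteq> snd (f n)"
  proof (rule dependent_nat_choice)
    obtain K W where "compactin (X 0) K" "saturated_in (X 0) K" "openin (X 0) W" "W \<subseteq> K" "K \<subseteq> V"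
      "{y \<in> topspace L. \<pi> 0 y \<in> W} \<in> \<U>"
      using scott_open_interpolate_compact[OF lc E(1) \<U> V] .
    then have "good 0 (K, W)" by (simp add: good_def)
    then show "\<exists>x. good 0 x" by (rule exI)
  next
    fix a n assume a: "good n a"
    define V' where "V' = {x \<in> topspace (X (Suc n)). p n (Suc n) x \<in> snd a}"
    have V'_open: "openin (X (Suc n)) V'"
      unfolding V'_def using a by (intro D(5)) (auto simp: good_def)
    have "{y \<in> topspace L. \<pi> (Suc n) y \<in> V'} = {y \<in> topspace L. \<pi> n y \<in> snd a}"
      using E(2)[of n "Suc n"] E(4) by (auto simp: V'_def)
    then have V'_\<U>: "{y \<in> topspace L. \<pi> (Suc n) y \<in> V'} \<in> \<U>"
      using a by (auto simp: good_def)
    obtain K W where "compactin (X (Suc n)) K" "saturated_in (X (Suc n)) K"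
      "openin (X (Suc n)) W" "W \<subseteq> K" "K \<subseteq> V'" "{y \<in> topspace L. \<pi> (Suc n) y \<in> W} \<in> \<U>"
      using scott_open_interpolate_compact[OF lc E(1) \<U> V'_open V'_\<U>] .
    then have "good (Suc n) (K, W)" "p n (Suc n) ` fst (K, W) \<subseteq> snd a"
      by (auto simp: good_def V'_def)
    then show "\<exists>y. good (Suc n) y \<and> p n (Suc n) ` fst y \<subseteq> snd a" by blast
  qed
  then obtain f where f: "\<And>n. good n (f n)" "\<And>n. p n (Suc n) ` fst (f (Suc n)) \<subseteq> snd (f n)"
    by metis
  define K W where "K n = fst (f n)" and "W n = snd (f n)" for n
  have cpt: "compactin (X n) (K n)" and sat: "saturated_in (X n) (K n)"
    and WK: "W n \<subseteq> K n" and W\<U>: "{y \<in> topspace L. \<pi> n y \<in> W n} \<in> \<U>" and K0: "K 0 \<subseteq> V" for n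
    using f(1)[of n] f(1)[of 0] by (auto simp: good_def K_def W_def split: prod.splits)
  have KT: "K n \<subseteq> topspace (X n)" for n using cpt by (simp add: compactin_def)
  have KK: "p m n ` K n \<subseteq> K m" if "m \<le> n" for m n
    using that
  proof (induction n rule: dec_induct)
    case base
    then show ?case using D(2) KT by fastforce
  next
    case (step n)
    show ?case
    proof
      fix z assume "z \<in> p m (Suc n) ` K (Suc n)"
      then obtain x where x: "x \<in> K (Suc n)" "z = p m (Suc n) x" by auto
      have "p n (Suc n) x \<in> K n" using f(2)[of n] x WK[of n] by (auto simp: K_def W_def)
      then have "p m n (p n (Suc n) x) \<in> K m" using step.IH by auto
      then show "z \<in> K m" using D(3)[of m n "Suc n" x] x subsetD[OF KT x(1)] step.hyps by simp
    qed
  qed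
  define Q where "Q = {y \<in> topspace L. \<forall>n. \<pi> n y \<in> K n}"
  note cover = limit_of_compacts_finite_cover[OF sys cone sober cpt sat KK, folded Q_def]
  show ?thesis
  proof
    show "compactin L Q"
      unfolding compactin_def
    proof (intro conjI allI impI)
      show "Q \<subseteq> topspace L" by (auto simp: Q_def)
      fix \<O> assume "(\<forall>U\<in>\<O>. openin L U) \<and> Q \<subseteq> \<Union>\<O>"
      then obtain m \<F> where \<F>: "finite \<F>" "\<F> \<subseteq> \<O>" "{y \<in> topspace L. \<pi> m y \<in> K m} \<subseteq> \<Union>\<F>"
        using cover[of \<O>] by metis
      moreover have "Q \<subseteq> {y \<in> topspace L. \<pi> m y \<in> K m}" by (auto simp: Q_def)
      ultimately show "\<exists>\<F>. finite \<F> \<and> \<F> \<subseteq> \<O> \<and> Q \<subseteq> \<Union>\<F>" by (meson order_trans)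
    qed
    show "saturated_in L Q"
    proof (rule saturated_inI)
      show "Q \<subseteq> topspace L" by (auto simp: Q_def)
      fix y assume "y \<in> topspace L" "y \<notin> Q"
      then obtain n where "\<pi> n y \<notin> K n" by (auto simp: Q_def)
      then obtain U where U: "openin (X n) U" "K n \<subseteq> U" "\<pi> n y \<notin> U"
        using saturated_inE[OF sat] by metis
      have "Q \<subseteq> {z \<in> topspace L. \<pi> n z \<in> U}" using U(2) by (auto simp: Q_def)
      then show "\<exists>U. openin L U \<and> Q \<subseteq> U \<and> y \<notin> U" using E(5)[OF U(1)] U(3) by blast
    qed
    show "Q \<subseteq> {y \<in> topspace L. \<pi> 0 y \<in> V}" using K0 by (auto simp: Q_def)
    fix O' assume O': "openin L O'" "Q \<subseteq> O'"
    have "\<exists>m. {y \<in> topspace L. \<pi> m y \<in> K m} \<subseteq> O'"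
    proof (rule cover[of "{O'}"])
      show "openin L U" if "U \<in> {O'}" for U using that O'(1) by simp
      show "Q \<subseteq> \<Union>{O'}" using O'(2) by simp
      fix \<F> m assume "\<F> \<subseteq> {O'}" "{y \<in> topspace L. \<pi> m y \<in> K m} \<subseteq> \<Union>\<F>"
      then have "{y \<in> topspace L. \<pi> m y \<in> K m} \<subseteq> O'" by auto
      then show ?thesis by (rule exI)
    qed
    then obtain m where "{y \<in> topspace L. \<pi> m y \<in> K m} \<subseteq> O'" by (elim exE)
    then have "{y \<in> topspace L. \<pi> m y \<in> W m} \<subseteq> O'" using WK[of m] by auto
    then show "O' \<in> \<U>" using S(2)[OF W\<U> O'(1)] by simp
  qed
qed

theorem consonant_limit:
  fixes X :: "nat \<Rightarrow> 'a topology"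
  assumes sys: "projective_system X p" and cone: "limit_cone X p L \<pi>"
    and lc: "\<And>n. locally_compact_base (X n)"
    and sober: "\<And>n. sober_space (X n)"
  shows "consonant_space L"
  unfolding consonant_space_def
proof (intro allI impI, elim conjE)
  fix \<U> U assume \<U>: "scott_open_opens L \<U>" "U \<in> \<U>"
  obtain n V where V: "openin (X n) V" "{y \<in> topspace L. \<pi> n y \<in> V} \<subseteq> U"
    "{y \<in> topspace L. \<pi> n y \<in> V} \<in> \<U>"
    using scott_open_contains_cylinder[OF sys cone \<U>] .
  obtain Q where Q: "compactin L Q" "saturated_in L Q" "Q \<subseteq> {y \<in> topspace L. \<pi> n y \<in> V}"
    "\<And>W. \<lbrakk>openin L W; Q \<subseteq> W\<rbrakk> \<Longrightarrow> W \<in> \<U>"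
    using scott_open_compact_saturated_below[OF projective_system_tail[OF sys, of n]
        limit_cone_tail[OF sys cone, of n] lc sober \<U>(1), of V] V by auto
  have "Q \<subseteq> U" using Q(3) V(2) by (rule order_trans)
  then show "\<exists>Q. compactin L Q \<and> saturated_in L Q \<and> Q \<subseteq> U \<and>
      (\<forall>V. openin L V \<and> Q \<subseteq> V \<longrightarrow> V \<in> \<U>)"
    using Q(1,2,4) by blast
qed

section \<open>Sobriety of limits\<close>

text \<open>
  The closures \<open>D' n\<close> of the projections of an irreducible closed \<open>C\<close> are irreducible. Bonding
  maps send their generic points to generic points, which are unique by the T0 axiom; so
  these form a thread \<open>y\<close>. Basic open sets of \<open>L\<close> come from a single level, where the generic
  point lies in exactly the open sets that meet the projection of \<open>C\<close>; so \<open>y\<close> is generic in \<open>C\<close>.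
\<close>

theorem sober_limit:
  fixes X :: "nat \<Rightarrow> 'a topology"
  assumes sys: "projective_system X p" and cone: "limit_cone X p L \<pi>"
    and sober: "\<And>n. sober_space (X n)"
  shows "sober_space L"
proof -
  note D = projective_systemD[OF sys] and E = limit_coneD[OF cone]
  have t0: "t0_space (X n)" for n using sober by (simp add: sober_space_def)
  have "t0_space L"
    unfolding t0_space_def
  proof (intro ballI impI)
    fix y z assume yz: "y \<in> topspace L" "z \<in> topspace L" "y \<noteq> z"
    then obtain n where "\<pi> n y \<noteq> \<pi> n z" using E(3) by metis
    then obtain U where "openin (X n) U" "(\<pi> n y \<notin> U) = (\<pi> n z \<in> U)"
      using t0[of n] E(4) yz unfolding t0_space_def by metis
    then show "\<exists>U. openin L U \<and> (y \<notin> U) = (z \<in> U)"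
      using E(5) yz by (intro exI[of _ "{w \<in> topspace L. \<pi> n w \<in> U}"]) auto
  qed
  moreover have "\<exists>y \<in> topspace L. C = L closure_of {y}" if irr: "irreducible_closed_in L C" for C
  proof -
    have C: "closedin L C" "C \<noteq> {}" using irr by (auto simp: irreducible_closed_in_def)
    have CT: "C \<subseteq> topspace L" using C closedin_subset by blast
    define D' where "D' n = X n closure_of (\<pi> n ` C)" for n
    have sub: "\<pi> n ` C \<subseteq> D' n" for n
      unfolding D'_def using CT E(4) by (intro closure_of_subset) auto
    have "irreducible_closed_in (X n) (D' n)" for n
      unfolding irreducible_closed_in_def
    proof (intro conjI allI impI)
      show "closedin (X n) (D' n)" by (simp add: D'_def)
      show "D' n \<noteq> {}" using sub[of n] C by auto
      fix F G assume FG: "closedin (X n) F \<and> closedin (X n) G \<and> D' n \<subseteq> F \<union> G"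
      have cl: "closedin L {y \<in> topspace L. \<pi> n y \<in> F}" "closedin L {y \<in> topspace L. \<pi> n y \<in> G}"
        using closedin_continuous_map_preimage[OF E(1)] FG by auto
      have "C \<subseteq> {y \<in> topspace L. \<pi> n y \<in> F} \<union> {y \<in> topspace L. \<pi> n y \<in> G}"
        using sub[of n] CT FG by blast
      then have "C \<subseteq> {y \<in> topspace L. \<pi> n y \<in> F} \<or> C \<subseteq> {y \<in> topspace L. \<pi> n y \<in> G}"
        using irr cl by (simp add: irreducible_closed_in_def)
      then have "\<pi> n ` C \<subseteq> F \<or> \<pi> n ` C \<subseteq> G" by auto
      then show "D' n \<subseteq> F \<or> D' n \<subseteq> G"
        unfolding D'_def using FG by (auto dest: closure_of_minimal)
    qed
    then have "\<exists>x \<in> topspace (X n). D' n = X n closure_of {x}" for n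
      using sober unfolding sober_space_def by simp
    then obtain x where xT: "\<And>n. x n \<in> topspace (X n)" and x: "\<And>n. D' n = X n closure_of {x n}"
      by metis
    have "p m n (x n) = x m" if "m \<le> n" for m n
    proof (rule t0_closure_sing_inject[OF t0])
      show "p m n (x n) \<in> topspace (X m)" "x m \<in> topspace (X m)"
        using D(4)[OF that] xT by auto
      have "X m closure_of {p m n (x n)} \<subseteq> D' m"
      proof -
        have "x n \<in> D' n" using x[of n] xT closure_of_subset[of "{x n}" "X n"] by auto
        then have "p m n (x n) \<in> X m closure_of (p m n ` (\<pi> n ` C))"
          using continuous_map_image_closure_subset[OF D(1)[OF that], of "\<pi> n ` C"]
          by (auto simp: D'_def)
        moreover have "p m n ` (\<pi> n ` C) = \<pi> m ` C"
          using E(2)[OF that] CT by (force simp: image_image)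
        ultimately show ?thesis by (simp add: D'_def closure_of_minimal)
      qed
      moreover have "D' m \<subseteq> X m closure_of {p m n (x n)}"
        unfolding D'_def
      proof (rule closure_of_minimal)
        show "\<pi> m ` C \<subseteq> X m closure_of {p m n (x n)}"
        proof
          fix z assume "z \<in> \<pi> m ` C"
          then obtain y where y: "y \<in> C" "z = \<pi> m y" by auto
          then have "\<pi> n y \<in> X n closure_of {x n}" using sub[of n] x[of n] by auto
          then have "p m n (\<pi> n y) \<in> X m closure_of {p m n (x n)}"
            using continuous_map_image_closure_subset[OF D(1)[OF that], of "{x n}"] by auto
          then show "z \<in> X m closure_of {p m n (x n)}" using E(2)[OF that] y CT by auto
        qed
      qed simp
      ultimately show "X m closure_of {p m n (x n)} = X m closure_of {x m}"
        using x[of m] by simp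
    qed
    then obtain y where y: "y \<in> topspace L" "\<And>n. \<pi> n y = x n"
      using limit_cone_lift[OF cone, of x] xT by metis
    have "y \<in> L closure_of C"
      unfolding in_closure_of
    proof (intro conjI allI impI)
      fix U assume U: "y \<in> U \<and> openin L U"
      then obtain n V where V: "openin (X n) V" "\<pi> n y \<in> V" "{z \<in> topspace L. \<pi> n z \<in> V} \<subseteq> U"
        using limit_cone_basis[OF cone] by metis
      have "x n \<in> D' n" using x[of n] xT closure_of_subset[of "{x n}" "X n"] by auto
      then obtain c where "c \<in> C" "\<pi> n c \<in> V"
        using V y unfolding D'_def in_closure_of by auto
      then show "\<exists>y. y \<in> C \<and> y \<in> U" using V(3) CT by auto
    qed fact
    then have "L closure_of {y} \<subseteq> C"
      using C by (simp add: closure_of_closedin closure_of_minimal)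
    moreover have "C \<subseteq> L closure_of {y}"
    proof
      fix c assume c: "c \<in> C"
      show "c \<in> L closure_of {y}"
        unfolding in_closure_of
      proof (intro conjI allI impI)
        show "c \<in> topspace L" using c CT by auto
        fix U assume U: "c \<in> U \<and> openin L U"
        then obtain n V where V: "openin (X n) V" "\<pi> n c \<in> V" "{z \<in> topspace L. \<pi> n z \<in> V} \<subseteq> U"
          using limit_cone_basis[OF cone] by metis
        have "\<pi> n c \<in> X n closure_of {x n}" using sub[of n] c x[of n] by auto
        then have "x n \<in> V" using V by (auto simp: in_closure_of)
        then show "\<exists>z. z \<in> {y} \<and> z \<in> U" using V(3) y by auto
      qed
    qed
    ultimately show ?thesis using y(1) by auto
  qed
  ultimately show ?thesis by (simp add: sober_space_def)
qed

section \<open>The canonical limit and its copowers\<close>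

lemma limit_cone_projective_limit:
  assumes sys: "projective_system X p"
  shows "limit_cone X p (projective_limit X p) (\<lambda>n x. x n)"
proof -
  note D = projective_systemD[OF sys]
  let ?L = "projective_limit X p"
  have top: "x \<in> topspace ?L \<longleftrightarrow>
      (\<forall>n. x n \<in> topspace (X n)) \<and> (\<forall>m n. m \<le> n \<longrightarrow> p m n (x n) = x m)" for x
    by (auto simp: projective_limit_def PiE_iff)
  have cont: "continuous_map ?L (X n) (\<lambda>x. x n)" for n
    unfolding projective_limit_def
    by (intro continuous_map_from_subtopology continuous_map_product_projection) simp
  have basis: "\<exists>n V. openin (X n) V \<and> y n \<in> V \<and> {z \<in> topspace ?L. z n \<in> V} \<subseteq> U"
    if U: "openin ?L U" "y \<in> U" for U y
  proof -
    have yL: "y \<in> topspace ?L" using U openin_subset by auto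
    obtain T where T: "openin (product_topology X UNIV) T"
      "U = T \<inter> {x. \<forall>m n. m \<le> n \<longrightarrow> p m n (x n) = x m}"
      using U(1) by (auto simp: projective_limit_def openin_subtopology)
    then have "\<exists>B. finite {i. B i \<noteq> topspace (X i)} \<and> (\<forall>i. openin (X i) (B i)) \<and>
        y \<in> Pi\<^sub>E UNIV B \<and> Pi\<^sub>E UNIV B \<subseteq> T"
      using U(2) unfolding openin_product_topology_alt by simp
    then obtain B where B: "finite {i. B i \<noteq> topspace (X i)}" "\<And>i. openin (X i) (B i)"
      "\<And>i. y i \<in> B i" "Pi\<^sub>E UNIV B \<subseteq> T"
      by (auto simp: PiE_iff)
    \<comment> \<open>The finitely many constraints of the box are all visible from the highest level
      that they involve.\<close>
    then obtain N where N: "\<And>i. B i \<noteq> topspace (X i) \<Longrightarrow> i \<le> N"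
      by (auto simp: finite_nat_set_iff_bounded_le)
    define V where "V = topspace (X N) \<inter> (\<Inter>i\<le>N. {x \<in> topspace (X N). p i N x \<in> B i})"
    have "openin (X N) V"
      unfolding V_def using D(5) B(2) by (intro openin_Int openin_INT) auto
    moreover have "y N \<in> V"
      using yL B(3) by (simp add: V_def top)
    moreover have "{z \<in> topspace ?L. z N \<in> V} \<subseteq> U"
    proof
      fix z assume z: "z \<in> {z \<in> topspace ?L. z N \<in> V}"
      then have zt: "z i \<in> topspace (X i)" and zp: "i \<le> n \<Longrightarrow> p i n (z n) = z i" for i n
        by (auto simp: top)
      have "z i \<in> B i" for i
      proof (cases "i \<le> N")
        case True
        then have "p i N (z N) \<in> B i" using z by (auto simp: V_def)
        then show ?thesis using zp[OF True] by simp
      next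
        case False
        then have "B i = topspace (X i)" using N by auto
        then show ?thesis using zt by simp
      qed
      then have "z \<in> T" using B(4) by (auto simp: PiE_iff)
      then show "z \<in> U" using zp by (simp add: T(2))
    qed
    ultimately show ?thesis by blast
  qed
  show ?thesis
    unfolding limit_cone_def
  proof (intro conjI allI impI ballI)
    show "continuous_map ?L (X n) (\<lambda>x. x n)" for n by (fact cont)
    show "m \<le> n \<Longrightarrow> p m n (y n) = y m" if "y \<in> topspace ?L" for m n y
      using that by (simp add: top)
    show "y = z" if "\<forall>n. y n = z n" for y z :: "nat \<Rightarrow> 'a" using that by (simp add: fun_eq_iff)
    show "\<exists>y \<in> topspace ?L. \<forall>n. y n = x n"
      if "(\<forall>n. x n \<in> topspace (X n)) \<and> (\<forall>m n. m \<le> n \<longrightarrow> p m n (x n) = x m)" for x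
      using that by (intro bexI[of _ x]) (simp_all add: top)
    show "\<exists>n V. openin (X n) V \<and> y n \<in> V \<and> {z \<in> topspace ?L. z n \<in> V} \<subseteq> U"
      if "openin ?L U \<and> y \<in> U" for U y
      using basis that by blast
  qed
qed

lemma topspace_copower: "topspace (copower k X) = {..<k} \<times> topspace X"
  by (simp add: copower_def comp_def)

lemma openin_copower:
  "openin (copower k X) U \<longleftrightarrow>
     U \<subseteq> {..<k} \<times> topspace X \<and> (\<forall>i<k. openin X {x. (i, x) \<in> U})"
  by (simp add: copower_def openin_sum_topology comp_def Ball_def)

lemma openin_copower_Times:
  assumes "i < k" "openin X U"
  shows "openin (copower k X) ({i} \<times> U)"
proof -
  have "{x. j = i \<and> x \<in> U} = (if j = i then U else {})" for j by auto
  then show ?thesis using assms openin_subset[OF assms(2)] by (auto simp: openin_copower)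
qed

lemma closedin_copower:
  "closedin (copower k X) U \<longleftrightarrow>
     U \<subseteq> {..<k} \<times> topspace X \<and> (\<forall>i<k. closedin X {x. (i, x) \<in> U})"
  by (simp add: copower_def closedin_sum_topology comp_def Ball_def)

lemma closedin_copower_Times:
  assumes "i < k" "closedin X F"
  shows "closedin (copower k X) ({i} \<times> F)"
proof -
  have "{x. j = i \<and> x \<in> F} = (if j = i then F else {})" for j by auto
  then show ?thesis using assms closedin_subset[OF assms(2)] by (auto simp: closedin_copower)
qed

lemma continuous_map_copower:
  assumes f: "continuous_map X Y f"
  shows "continuous_map (copower k X) (copower k Y) (map_prod id f)"
  unfolding continuous_map_def
proof (intro conjI allI impI)
  have fT: "f x \<in> topspace Y" if "x \<in> topspace X" for x
    using f that by (auto simp: continuous_map_def)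
  show "map_prod id f \<in> topspace (copower k X) \<rightarrow> topspace (copower k Y)"
    using fT by (auto simp: topspace_copower)
  fix U assume U: "openin (copower k Y) U"
  have "openin X {x. (i, x) \<in> {z \<in> topspace (copower k X). map_prod id f z \<in> U}}" if "i < k" for i
  proof -
    have "openin Y {y. (i, y) \<in> U}" using U that by (simp add: openin_copower)
    then have "openin X {x \<in> topspace X. f x \<in> {y. (i, y) \<in> U}}"
      using f openin_continuous_map_preimage by blast
    moreover have "{x. (i, x) \<in> {z \<in> topspace (copower k X). map_prod id f z \<in> U}} =
        {x \<in> topspace X. f x \<in> {y. (i, y) \<in> U}}"
      using that by (auto simp: topspace_copower)
    ultimately show ?thesis by simp
  qed
  then show "openin (copower k X) {z \<in> topspace (copower k X). map_prod id f z \<in> U}"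
    unfolding openin_copower by (auto simp: topspace_copower)
qed

lemma projective_system_copower:
  assumes sys: "projective_system X p"
  shows "projective_system (\<lambda>n. copower k (X n)) (\<lambda>m n. map_prod id (p m n))"
  using projective_systemD(1-3)[OF sys] unfolding projective_system_def
  by (auto simp: topspace_copower intro: continuous_map_copower)

text \<open>
  Copowers commute with projective limits: the bonding maps preserve the index of the
  summand, so a thread of the copowers stays in one summand.
\<close>

lemma limit_cone_copower:
  assumes cone: "limit_cone X p L \<pi>"
  shows "limit_cone (\<lambda>n. copower k (X n)) (\<lambda>m n. map_prod id (p m n)) (copower k L)
           (\<lambda>n. map_prod id (\<pi> n))"
proof -
  note E = limit_coneD[OF cone]
  have inj: "y = z"
    if yz: "y \<in> topspace (copower k L)" "z \<in> topspace (copower k L)"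
      "\<And>n. map_prod id (\<pi> n) y = map_prod id (\<pi> n) z" for y z
  proof -
    obtain i a j b where ab: "y = (i, a)" "z = (j, b)" "a \<in> topspace L" "b \<in> topspace L"
      using yz(1,2) by (auto simp: topspace_copower)
    have "i = j" "\<And>n. \<pi> n a = \<pi> n b" using yz(3) ab by auto
    then show ?thesis using E(3)[OF ab(3,4)] ab by simp
  qed
  have lift: "\<exists>y \<in> topspace (copower k L). \<forall>n. map_prod id (\<pi> n) y = x n"
    if x: "\<And>n. x n \<in> topspace (copower k (X n))"
      "\<And>m n. m \<le> n \<Longrightarrow> map_prod id (p m n) (x n) = x m" for x
  proof -
    define i where "i = fst (x 0)"
    define a where "a n = snd (x n)" for n
    have "fst (x n) = i" for n
      using x(2)[of 0 n] by (metis fst_map_prod i_def id_apply le0)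
    then have xa: "x n = (i, a n)" for n by (metis a_def prod.collapse)
    then have "i < k" "\<And>n. a n \<in> topspace (X n)" "\<And>m n. m \<le> n \<Longrightarrow> p m n (a n) = a m"
      using x by (auto simp: topspace_copower)
    moreover from this obtain y where "y \<in> topspace L" "\<And>n. \<pi> n y = a n"
      using limit_cone_lift[OF cone, of a] by metis
    ultimately show ?thesis
      by (intro bexI[of _ "(i, y)"]) (simp_all add: xa topspace_copower)
  qed
  have basis: "\<exists>n V. openin (copower k (X n)) V \<and> map_prod id (\<pi> n) y \<in> V \<and>
      {z \<in> topspace (copower k L). map_prod id (\<pi> n) z \<in> V} \<subseteq> U"
    if U: "openin (copower k L) U" "y \<in> U" for U y
  proof -
    obtain i a where ia: "y = (i, a)" "i < k"
      using U by (auto simp: openin_copower)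
    have "openin L {a. (i, a) \<in> U}" using U ia by (simp add: openin_copower)
    then obtain n V where V: "openin (X n) V" "\<pi> n a \<in> V" "{z \<in> topspace L. \<pi> n z \<in> V} \<subseteq> {a. (i, a) \<in> U}"
      using limit_cone_basis[OF cone, of "{a. (i, a) \<in> U}" a] U(2) ia by auto
    have "{z \<in> topspace (copower k L). map_prod id (\<pi> n) z \<in> {i} \<times> V} \<subseteq> U"
      using V(3) by (auto simp: topspace_copower)
    then show ?thesis
      using openin_copower_Times[OF ia(2) V(1)] V(2) ia
      by (intro exI[of _ n] exI[of _ "{i} \<times> V"]) simp
  qed
  show ?thesis
    unfolding limit_cone_def
  proof (intro conjI allI impI ballI)
    show "continuous_map (copower k L) (copower k (X n)) (map_prod id (\<pi> n))" for n
      using continuous_map_copower[OF E(1)] .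
    show "map_prod id (p m n) (map_prod id (\<pi> n) y) = map_prod id (\<pi> m) y"
      if "y \<in> topspace (copower k L)" "m \<le> n" for m n y
      using that E(2) by (auto simp: topspace_copower)
  qed (use inj lift basis in simp_all)
qed

lemma locally_compact_base_copower:
  assumes "locally_compact_base X"
  shows "locally_compact_base (copower k X)"
  unfolding locally_compact_base_def neighbourhood_base_of
proof (intro allI impI)
  fix W z assume W: "openin (copower k X) W \<and> z \<in> W"
  then obtain i x where z: "z = (i, x)" "i < k" by (auto simp: openin_copower)
  have "openin X {x. (i, x) \<in> W}" "x \<in> {x. (i, x) \<in> W}"
    using W z by (auto simp: openin_copower)
  then obtain U K where UK: "openin X U" "compactin X K" "x \<in> U" "U \<subseteq> K" "K \<subseteq> {x. (i, x) \<in> W}"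
    using assms[unfolded locally_compact_base_def neighbourhood_base_of] by metis
  have "compactin (copower k X) (Pair i ` K)"
    using UK(2) z(2) unfolding copower_def
    by (intro image_compactin[OF _ continuous_map_component_injection]) simp_all
  moreover have "Pair i ` K = {i} \<times> K" by auto
  ultimately show "\<exists>U K. openin (copower k X) U \<and> compactin (copower k X) K \<and> z \<in> U \<and> U \<subseteq> K \<and> K \<subseteq> W"
    using UK z openin_copower_Times[OF z(2) UK(1)]
    by (intro exI[of _ "{i} \<times> U"] exI[of _ "{i} \<times> K"]) auto
qed

text \<open>
  Each summand is open and closed, so an irreducible closed set lies in a single one and has
  its generic point there.
\<close>

lemma sober_space_copower:
  assumes sober: "sober_space X"
  shows "sober_space (copower k X)"
proof -
  have t0: "t0_space X" using sober by (simp add: sober_space_def)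
  have "t0_space (copower k X)"
    unfolding t0_space_def
  proof (intro ballI impI)
    fix y z assume yz: "y \<in> topspace (copower k X)" "z \<in> topspace (copower k X)" "y \<noteq> z"
    then obtain i a j b where ab: "y = (i, a)" "z = (j, b)" "i < k" "j < k"
      "a \<in> topspace X" "b \<in> topspace X"
      by (auto simp: topspace_copower)
    show "\<exists>U. openin (copower k X) U \<and> (y \<notin> U) = (z \<in> U)"
    proof (cases "i = j")
      case True
      then obtain U where "openin X U" "(a \<notin> U) = (b \<in> U)"
        using t0 ab yz(3) unfolding t0_space_def by auto
      then show ?thesis
        using openin_copower_Times[OF ab(3)] ab True by (intro exI[of _ "{i} \<times> U"]) auto
    next
      case False
      then show ?thesis
        using openin_copower_Times[OF ab(3) openin_topspace] ab
        by (intro exI[of _ "{i} \<times> topspace X"]) auto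
    qed
  qed
  moreover have "\<exists>z \<in> topspace (copower k X). C = copower k X closure_of {z}"
    if irr: "irreducible_closed_in (copower k X) C" for C
  proof -
    have C: "closedin (copower k X) C" "C \<noteq> {}"
      using irr by (simp_all add: irreducible_closed_in_def)
    have split: "C \<subseteq> F \<or> C \<subseteq> G"
      if "closedin (copower k X) F" "closedin (copower k X) G" "C \<subseteq> F \<union> G" for F G
      using irr that by (simp add: irreducible_closed_in_def)
    have CT: "C \<subseteq> {..<k} \<times> topspace X" using C(1) by (simp add: closedin_copower)
    obtain i a where a: "(i, a) \<in> C" "i < k" using C(2) CT by fastforce
    define C' where "C' = {x. (i, x) \<in> C}"
    let ?T = "{i} \<times> topspace X"
    have "closedin (copower k X) ?T" using closedin_copower_Times[OF a(2) closedin_topspace] .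
    moreover have "closedin (copower k X) (topspace (copower k X) - ?T)"
      using openin_copower_Times[OF a(2) openin_topspace] by (intro closedin_diff) auto
    moreover have "C \<subseteq> ?T \<union> (topspace (copower k X) - ?T)"
      using CT by (auto simp: topspace_copower)
    ultimately have "C \<subseteq> ?T"
      using split[of ?T "topspace (copower k X) - ?T"] a CT by auto
    then have CC': "C = {i} \<times> C'" by (auto simp: C'_def)
    have "irreducible_closed_in X C'"
      unfolding irreducible_closed_in_def
    proof (intro conjI allI impI)
      show "closedin X C'" using C(1) a(2) by (simp add: closedin_copower C'_def)
      show "C' \<noteq> {}" using a by (auto simp: C'_def)
      fix F G assume FG: "closedin X F \<and> closedin X G \<and> C' \<subseteq> F \<union> G"
      then have "C \<subseteq> {i} \<times> F \<or> C \<subseteq> {i} \<times> G"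
        using closedin_copower_Times[OF a(2)] by (intro split) (auto simp: CC')
      then show "C' \<subseteq> F \<or> C' \<subseteq> G" by (auto simp: C'_def)
    qed
    then obtain x where x: "x \<in> topspace X" "C' = X closure_of {x}"
      using sober unfolding sober_space_def by metis
    have "(i, x) \<in> C" using x closure_of_subset[of "{x}" X] by (auto simp: CC')
    then have "copower k X closure_of {(i, x)} \<subseteq> C"
      using C(1) by (intro closure_of_minimal) auto
    moreover have "C \<subseteq> copower k X closure_of {(i, x)}"
    proof
      fix c assume "c \<in> C"
      then obtain y where y: "c = (i, y)" "y \<in> X closure_of {x}" using CC' x(2) by auto
      have "Pair i ` (X closure_of {x}) \<subseteq> copower k X closure_of (Pair i ` {x})"
        unfolding copower_def using a(2)
        by (intro continuous_map_image_closure_subset continuous_map_component_injection) simp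
      then show "c \<in> copower k X closure_of {(i, x)}" using y by auto
    qed
    ultimately show ?thesis
      using x(1) a(2) by (intro bexI[of _ "(i, x)"]) (auto simp: topspace_copower)
  qed
  ultimately show ?thesis by (simp add: sober_space_def)
qed

theorem theorem12p17:
  fixes X :: "nat \<Rightarrow> 'a topology"
    and p :: "nat \<Rightarrow> nat \<Rightarrow> 'a \<Rightarrow> 'a"
  assumes "projective_system X p"
    and "\<And>n. locally_compact_base (X n)"
    and "\<And>n. sober_space (X n)"
  shows "odot_consonant_space (projective_limit X p) \<and> sober_space (projective_limit X p)"
proof
  note cone = limit_cone_projective_limit[OF assms(1)]
  show "sober_space (projective_limit X p)"
    using sober_limit[OF assms(1) cone assms(3)] .
  show "odot_consonant_space (projective_limit X p)"
    unfolding odot_consonant_space_def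
  proof
    show "consonant_space (copower k (projective_limit X p))" for k
      by (rule consonant_limit[OF projective_system_copower[OF assms(1)] limit_cone_copower[OF cone]])
        (simp_all add: locally_compact_base_copower sober_space_copower assms(2,3))
  qed
qed

end
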